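(* Let $n,m\in\mathbb{N}$ with $1\le m\le n-1$, and let $(M_m(t),N_m(t))$ be a Luchko pair of kernels from the Luchko set $L_m$. Then the pair of kernels $$M_{m,n-m}(t) = (\{1\}^{n-m} * M_m)(t), \quad N_{m,0}(t) = N_m(t)$$ belongs to the Luchko set $L_n$.
   Context: $C_{-1}(0,\infty)$ is the space of functions $f$ on $(0,\infty)$ that can be represented as $f(t)=t^p g(t)$ for $t>0$ with some $p>-1$ and $g\in C[0,\infty)$. The symbol $*$ denotes the Laplace convolution $(f*g)(t)=\int_0^t f(t-\tau)g(\tau)\,d\tau$, $t>0$. $\{1\}$ is the function identically equal to $1$, and for $n\in\mathbb{N}$, $\{1\}^n$ is its $n$-fold convolution power, $\{1\}^n=h_n(t)=\frac{t^{n-1}}{(n-1)!}$. For $n\in\mathbb{N}$, the Luchko set $L_n$ is the set of pairs $(M(t),N(t))$ (Luchko pairs) with $M,N\in C_{-1}(0,\infty)$ such that $(M*N)(t)=\{1\}^n$ for all $t\in(0,\infty)$. *)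

theory Defs
  imports "HOL-Analysis.Analysis"
begin

(* Functions on (0,\<infinity>) are modelled as total functions on the reals; no notion below
   depends on their values outside (0,\<infinity>). *)

definition C_minus_one :: "(real \<Rightarrow> real) set" where
  "C_minus_one =
     {f. \<exists>p g. p > -1 \<and> continuous_on {0..} g \<and> (\<forall>t>0. f t = t powr p * g t)}"

(* The open interval of integration keeps both arguments, t - s and s, in (0,\<infinity>). *)

definition laplace_conv :: "(real \<Rightarrow> real) \<Rightarrow> (real \<Rightarrow> real) \<Rightarrow> real \<Rightarrow> real" where
  "laplace_conv f g t = (LBINT s:{0<..<t}. f (t - s) * g s)"

(* The n-fold convolution power for n \<ge> 1. The convolution has no unit among functions, so
   there is no power 0; the value at n = 0 is meaningless. *)

definition conv_power :: "(real \<Rightarrow> real) \<Rightarrow> nat \<Rightarrow> real \<Rightarrow> real" where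
  "conv_power f n = (laplace_conv f ^^ (n - 1)) f"

definition luchko_set :: "nat \<Rightarrow> ((real \<Rightarrow> real) \<times> (real \<Rightarrow> real)) set" where
  "luchko_set n =
     {(M, N). M \<in> C_minus_one \<and> N \<in> C_minus_one \<and>
        (\<forall>t>0. laplace_conv M N t = conv_power (\<lambda>_. 1) n t)}"

lemma conv_power_one_eq:
  assumes "n \<ge> 1" "t > 0"
  shows "conv_power (\<lambda>_. 1) n t = t ^ (n - 1) / fact (n - 1)"
proof -
  have "(laplace_conv (\<lambda>_. 1) ^^ k) (\<lambda>_. 1) t = t ^ k / fact k" if "t > 0" for k t
    using that
  proof (induction k arbitrary: t)
    case 0
    show ?case by simp
  next
    case (Suc k)
    have "(laplace_conv (\<lambda>_. 1) ^^ Suc k) (\<lambda>_. 1) t =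
            (LBINT s:{0<..<t}. (laplace_conv (\<lambda>_. 1) ^^ k) (\<lambda>_. 1) s)"
      by (subst funpow.simps) (simp add: laplace_conv_def [of _ _ t])
    also have "\<dots> = (LBINT s:{0<..<t}. s ^ k / fact k)"
      using Suc.IH by (intro set_lebesgue_integral_cong) auto
    also have "\<dots> = (LBINT s=0..t. s ^ k / fact k)"
      using Suc.prems by (simp add: interval_lebesgue_integral_def einterval_eq zero_ereal_def)
    also have "\<dots> = t ^ Suc k / fact (Suc k) - 0 ^ Suc k / fact (Suc k)"
      unfolding zero_ereal_def
    proof (rule interval_integral_FTC_finite)
      show "continuous_on {min 0 t..max 0 t} (\<lambda>s. s ^ k / fact k :: real)"
        by (intro continuous_intros) auto
      show "((\<lambda>s. s ^ Suc k / fact (Suc k)) has_vector_derivative x ^ k / fact k)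
              (at x within {min 0 t..max 0 t})" for x :: real
        unfolding has_real_derivative_iff_has_vector_derivative[symmetric]
      proof -
        have "((\<lambda>s. s ^ Suc k / fact (Suc k)) has_real_derivative
                (real (Suc k) * x ^ k) / fact (Suc k)) (at x within {min 0 t..max 0 t})"
          by (intro DERIV_cdivide) (auto intro!: derivative_eq_intros simp del: power_Suc)
        also have "(real (Suc k) * x ^ k) / fact (Suc k) = x ^ k / fact k"
          unfolding fact_Suc by (simp del: of_nat_Suc)
        finally show "((\<lambda>s. s ^ Suc k / fact (Suc k)) has_real_derivative x ^ k / fact k)
                (at x within {min 0 t..max 0 t})" .
      qed
    qed
    finally show ?case by simp
  qed
  with assms show ?thesis by (simp add: conv_power_def)
qed

end

theory Submission
  imports Defs
begin

text \<open>Convolution with the constant function \<open>1\<close> is the integration operator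
  \<open>J f t = \<integral>\<^sub>0\<^sup>t f\<close>, so \<open>{1}\<^sup>k = J\<^sup>k\<^sup>-\<^sup>1 1\<close> and the theorem is a statement about
  powers of \<open>J\<close>. Two properties of \<open>J\<close> carry it. It maps \<open>C\<^sub>-\<^sub>1\<close> into itself, since functions
  in \<open>C\<^sub>-\<^sub>1\<close> are integrable at \<open>0\<close> and their integrals are continuous on \<open>[0,\<infinity>)\<close>
  (\<open>C_minus_one_conv_one\<close>). It can be pulled out of the first factor of a convolution,
  \<open>J f * g = J (f * g)\<close>, which is Fubini on the triangle \<open>0 < s < u < t\<close> (\<open>conv_one_assoc\<close>).

  Iterating the second property gives \<open>J\<^sup>k f * g = J\<^sup>k (f * g)\<close>. With \<open>f = 1\<close>, \<open>g = M\<close> and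
  \<open>k = n - m - 1\<close> it shows \<open>{1}\<^sup>n\<^sup>-\<^sup>m * M = J\<^sup>n\<^sup>-\<^sup>m M\<close>, which lies in \<open>C\<^sub>-\<^sub>1\<close>. With \<open>f = M\<close>, \<open>g = N\<close>
  and \<open>k = n - m\<close> it shows \<open>J\<^sup>n\<^sup>-\<^sup>m M * N = J\<^sup>n\<^sup>-\<^sup>m (M * N) = J\<^sup>n\<^sup>-\<^sup>m {1}\<^sup>m = {1}\<^sup>n\<close>.

  All these identities are only claimed on \<open>(0,\<infinity>)\<close>. They can be chained because a convolution
  at \<open>t > 0\<close> depends only on the values of its factors on \<open>(0,t)\<close>.\<close>

lemma laplace_conv_cong:
  assumes "\<And>s. 0 < s \<Longrightarrow> s < t \<Longrightarrow> f s = f' s" "\<And>s. 0 < s \<Longrightarrow> s < t \<Longrightarrow> g s = g' s"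
  shows "laplace_conv f g t = laplace_conv f' g' t"
  unfolding laplace_conv_def using assms by (intro set_lebesgue_integral_cong) auto

lemma funpow_conv_cong:
  assumes "\<And>s. 0 < s \<Longrightarrow> f s = g s" and "0 < t"
  shows "(laplace_conv h ^^ k) f t = (laplace_conv h ^^ k) g t"
  using assms(2)
proof (induction k arbitrary: t)
  case (Suc k)
  then show ?case
    unfolding funpow.simps o_def by (intro laplace_conv_cong) auto
qed (simp add: assms(1))

lemma C_minus_one_cong:
  assumes "\<And>t. 0 < t \<Longrightarrow> f t = g t"
  shows "f \<in> C_minus_one \<longleftrightarrow> g \<in> C_minus_one"
proof -
  have "(\<forall>t>0. f t = t powr p * h t) \<longleftrightarrow> (\<forall>t>0. g t = t powr p * h t)"
    for p and h :: "real \<Rightarrow> real"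
    using assms by simp
  then show ?thesis
    by (simp add: C_minus_one_def)
qed

lemma continuous_imp_C_minus_one:
  assumes "continuous_on {0..} f"
  shows "f \<in> C_minus_one"
proof -
  have "(0::real) > -1 \<and> continuous_on {0..} f \<and> (\<forall>t>0. f t = t powr 0 * f t)"
    using assms by simp
  then show ?thesis
    unfolding C_minus_one_def by blast
qed

text \<open>The exponent condition \<open>p > -1\<close> in the representation \<open>t\<^sup>p g(t)\<close> is exactly integrability
  of the power at \<open>0\<close>, and the continuous factor is bounded on \<open>[0,T]\<close>.\<close>

lemma C_minus_one_set_integrable:
  assumes "f \<in> C_minus_one"
  shows "set_integrable lborel {0<..<T} f"
proof (cases "T > 0")
  case True
  obtain p g where p: "p > -1" and g: "continuous_on {0..} g"
    and f: "\<And>t. t > 0 \<Longrightarrow> f t = t powr p * g t"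
    using assms unfolding C_minus_one_def by blast
  have g': "continuous_on {0..T} g"
    using g by (rule continuous_on_subset) auto
  then have "bounded (g ` {0..T})"
    by (intro compact_imp_bounded compact_continuous_image) auto
  then obtain B where B: "\<And>t. t \<in> {0..T} \<Longrightarrow> \<bar>g t\<bar> \<le> B"
    unfolding bounded_iff real_norm_def by blast
  have "(\<lambda>s. s powr p) absolutely_integrable_on {0..T}"
    using integrable_on_powr_from_0[of p T] p True
    by (intro nonnegative_absolutely_integrable_1) auto
  then have "integrable lborel (\<lambda>s. indicator {0..T} s *\<^sub>R (s powr p))"
    unfolding set_integrable_def by (subst (asm) integrable_completion) auto
  then have "integrable lborel (\<lambda>s. B * (indicator {0..T} s *\<^sub>R (s powr p)))"
    by (rule integrable_mult_right)
  moreover have "(\<lambda>s. indicator {0<..<T} s *\<^sub>R f s) \<in> borel_measurable lborel"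
  proof -
    have "continuous_on {0<..<T} (\<lambda>s. s powr p * g s)"
      by (intro continuous_intros continuous_on_subset[OF g']) auto
    then have "continuous_on {0<..<T} f"
      using f by (subst continuous_on_cong[OF refl, of _ _ "\<lambda>s. s powr p * g s"]) auto
    then show ?thesis
      using borel_measurable_continuous_on_indicator[of "{0<..<T}" f] by simp
  qed
  moreover have "norm (indicator {0<..<T} s *\<^sub>R f s)
      \<le> norm (B * (indicator {0..T} s *\<^sub>R (s powr p)))" for s
  proof (cases "s \<in> {0<..<T}")
    case True
    then have "\<bar>g s\<bar> * s powr p \<le> \<bar>B\<bar> * s powr p"
      using B[of s] by (intro mult_right_mono) auto
    then show ?thesis
      using True f[of s] by (simp add: abs_mult mult.commute)
  qed simp
  ultimately show ?thesis
    unfolding set_integrable_def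
    by (intro AE_I2 Bochner_Integration.integrable_bound
        [where g = "\<lambda>s. indicator {0<..<T} s *\<^sub>R f s"])
qed (simp add: set_integrable_def)

text \<open>The integral \<open>\<integral>\<^sub>0\<^sup>T f\<close> depends continuously on \<open>T\<close>, down to \<open>T = 0\<close>, as soon as \<open>f\<close> is
  integrable at \<open>0\<close>. Hence the exponent \<open>p = 0\<close> represents it, whatever exponent \<open>f\<close> has.\<close>

lemma C_minus_one_conv_one:
  assumes "f \<in> C_minus_one"
  shows "laplace_conv (\<lambda>_. 1) f \<in> C_minus_one"
proof -
  have eq: "laplace_conv (\<lambda>_. 1) f T = integral {0..T} f" and int: "f integrable_on {0..T}" for T
  proof -
    have i: "set_integrable lborel {0<..<T} f"
      by (rule C_minus_one_set_integrable[OF assms])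
    have "(f has_integral laplace_conv (\<lambda>_. 1) f T) {0<..<T}"
      using set_borel_integral_eq_integral[OF i]
      by (simp add: laplace_conv_def has_integral_integrable_integral)
    then have "(f has_integral laplace_conv (\<lambda>_. 1) f T) {0..T}"
      by (simp only: has_integral_Icc_iff_Ioo)
    then show "laplace_conv (\<lambda>_. 1) f T = integral {0..T} f" "f integrable_on {0..T}"
      by (auto simp: integral_unique)
  qed
  have "continuous_on {0..} (\<lambda>T. integral {0..T} f)"
    unfolding continuous_on_eq_continuous_within
  proof
    fix x :: real assume x: "x \<in> {0..}"
    have "continuous_on {0..x+1} (\<lambda>T. integral {0..T} f)"
      by (rule indefinite_integral_continuous_1[OF int])
    then have "continuous (at x within {0..x+1}) (\<lambda>T. integral {0..T} f)"
      using x by (auto simp: continuous_on_eq_continuous_within)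
    moreover have "at x within {0..x+1} = at x within {0..}"
      using x by (intro at_within_nhd[of _ "{..<x+1}"]) auto
    ultimately show "continuous (at x within {0..}) (\<lambda>T. integral {0..T} f)"
      by simp
  qed
  then show ?thesis
    using continuous_imp_C_minus_one eq by presburger
qed

lemma C_minus_one_funpow_conv_one:
  "f \<in> C_minus_one \<Longrightarrow> (laplace_conv (\<lambda>_. 1) ^^ k) f \<in> C_minus_one"
  by (induction k) (auto intro: C_minus_one_conv_one)

text \<open>Both sides integrate \<open>f (u - s) * g s\<close> over the triangle \<open>0 < s < u < t\<close>: the left one
  over \<open>u\<close> first, after the shift \<open>r = u - s\<close>, and the right one over \<open>s\<close> first. Cutting \<open>f\<close>
  and \<open>g\<close> off outside \<open>(0,t)\<close> makes them integrable on the whole line, so that the product is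
  integrable on the plane, and then only the cut \<open>u < t\<close> remains to describe the triangle.\<close>

lemma conv_one_assoc:
  assumes f: "set_integrable lborel {0<..<t} f" and g: "set_integrable lborel {0<..<t} g"
  shows "laplace_conv (laplace_conv (\<lambda>_. 1) f) g t = laplace_conv (\<lambda>_. 1) (laplace_conv f g) t"
proof -
  define f0 where "f0 = (\<lambda>s. indicator {0<..<t} s *\<^sub>R f s)"
  define g0 where "g0 = (\<lambda>s. indicator {0<..<t} s *\<^sub>R g s)"
  have f0: "integrable lborel f0" and g0: "integrable lborel g0"
    using f g by (auto simp: set_integrable_def f0_def g0_def)
  have [measurable]: "f0 \<in> borel_measurable borel" "g0 \<in> borel_measurable borel"
    using f0 g0 by (auto dest: borel_measurable_integrable)
  define H where "H = (\<lambda>s u. indicator {..<t} u * (f0 (u - s) * g0 s))"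
  have shift: "integrable lborel (\<lambda>u. f0 (u - s))" for s
    using lborel_integrable_real_affine[OF f0, of 1 "-s"] by simp
  have shift_norm: "(LBINT u. \<bar>f0 (u - s)\<bar>) = (LBINT r. \<bar>f0 r\<bar>)" for s
    using lborel_integral_real_affine[of 1 "\<lambda>r. \<bar>f0 r\<bar>" "-s"] by simp
  have "integrable (lborel \<Otimes>\<^sub>M lborel) (\<lambda>(s, u). f0 (u - s) * g0 s)"
  proof (rule lborel_pair.Fubini_integrable)
    have "(LBINT u. norm (case (s, u) of (s, u) \<Rightarrow> f0 (u - s) * g0 s))
        = (LBINT r. \<bar>f0 r\<bar>) * \<bar>g0 s\<bar>" for s
      by (simp add: abs_mult shift_norm)
    then show "integrable lborel (\<lambda>s. LBINT u. norm (case (s, u) of (s, u) \<Rightarrow> f0 (u - s) * g0 s))"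
      using g0 by simp
  qed (use shift in auto)
  then have "integrable (lborel \<Otimes>\<^sub>M lborel) (\<lambda>(s, u). H s u)"
    by (rule Bochner_Integration.integrable_bound) (auto simp: H_def indicator_def)
  then have fubini: "(LBINT u. LBINT s. H s u) = (LBINT s. LBINT u. H s u)"
    by (rule lborel_pair.Fubini_integral)
  have "(LBINT u. H s u) = indicator {0<..<t} s *\<^sub>R (laplace_conv (\<lambda>_. 1) f (t - s) * g s)" for s
  proof (cases "s \<in> {0<..<t}")
    case True
    have "(LBINT u. H s u) = (LBINT u. indicator {..<t} u * f0 (u - s)) * g s"
      using True by (simp add: H_def g0_def flip: mult.assoc)
    also have "(LBINT u. indicator {..<t} u * f0 (u - s))
        = (LBINT r. indicator {..<t} (s + r) * f0 r)"
      using lborel_integral_real_affine[of 1 "\<lambda>u. indicator {..<t} u * f0 (u - s)" s] by simp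
    also have "\<dots> = laplace_conv (\<lambda>_. 1) f (t - s)"
      unfolding laplace_conv_def set_lebesgue_integral_def f0_def using True
      by (intro Bochner_Integration.integral_cong) (auto simp: indicator_def)
    finally show ?thesis
      using True by simp
  qed (simp add: H_def g0_def)
  moreover have "(LBINT s. H s u) = indicator {0<..<t} u *\<^sub>R laplace_conv f g u" for u
  proof (cases "u \<in> {0<..<t}")
    case True
    then have "(LBINT s. H s u) = laplace_conv f g u"
      unfolding laplace_conv_def set_lebesgue_integral_def H_def f0_def g0_def
      by (intro Bochner_Integration.integral_cong) (auto simp: indicator_def)
    then show ?thesis
      using True by simp
  next
    case False
    then have "H s u = 0" for s
      by (auto simp: H_def f0_def g0_def indicator_def)
    then show ?thesis
      using False by simp
  qed
  ultimately show ?thesis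
    using fubini by (simp add: laplace_conv_def[of _ _ t] set_lebesgue_integral_def)
qed

lemma funpow_conv_one_assoc:
  assumes "f \<in> C_minus_one" and "g \<in> C_minus_one" and "t > 0"
  shows "laplace_conv ((laplace_conv (\<lambda>_. 1) ^^ k) f) g t
       = (laplace_conv (\<lambda>_. 1) ^^ k) (laplace_conv f g) t"
  using assms(3)
proof (induction k arbitrary: t)
  case (Suc k)
  let ?J = "laplace_conv (\<lambda>_. 1)"
  have "laplace_conv (?J ((?J ^^ k) f)) g t = ?J (laplace_conv ((?J ^^ k) f) g) t"
    using assms(1,2)
    by (intro conv_one_assoc C_minus_one_set_integrable C_minus_one_funpow_conv_one)
  also have "\<dots> = ?J ((?J ^^ k) (laplace_conv f g)) t"
    using Suc.IH by (intro laplace_conv_cong) auto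
  finally show ?case
    by simp
qed simp

theorem theorem2:
  fixes n m :: nat and M N :: "real \<Rightarrow> real"
  assumes "1 \<le> m" and "m \<le> n - 1"
    and "(M, N) \<in> luchko_set m"
  shows "(laplace_conv (conv_power (\<lambda>_. 1) (n - m)) M, N) \<in> luchko_set n"
proof -
  let ?J = "laplace_conv (\<lambda>_. 1)"
  let ?M' = "laplace_conv (conv_power (\<lambda>_. 1) (n - m)) M"
  have M: "M \<in> C_minus_one" and N: "N \<in> C_minus_one"
    and MN: "\<And>t. t > 0 \<Longrightarrow> laplace_conv M N t = conv_power (\<lambda>_. 1) m t"
    using assms(3) by (auto simp: luchko_set_def)
  have one: "(\<lambda>_. 1) \<in> C_minus_one"
    by (intro continuous_imp_C_minus_one continuous_intros)
  have M': "?M' t = (?J ^^ (n - m)) M t" if "t > 0" for t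
  proof -
    have "?M' t = (?J ^^ (n - m - 1)) (?J M) t"
      unfolding conv_power_def by (rule funpow_conv_one_assoc[OF one M that])
    also have "\<dots> = (?J ^^ Suc (n - m - 1)) M t"
      by (simp only: funpow_Suc_right o_def)
    also have "Suc (n - m - 1) = n - m"
      using assms(1,2) by simp
    finally show ?thesis .
  qed
  have "?M' \<in> C_minus_one"
    by (subst C_minus_one_cong[OF M']) (simp_all add: C_minus_one_funpow_conv_one M)
  moreover have "laplace_conv ?M' N t = conv_power (\<lambda>_. 1) n t" if "t > 0" for t
  proof -
    have "laplace_conv ?M' N t = laplace_conv ((?J ^^ (n - m)) M) N t"
      using M' by (intro laplace_conv_cong) auto
    also have "\<dots> = (?J ^^ (n - m)) (laplace_conv M N) t"
      by (rule funpow_conv_one_assoc[OF M N that])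
    also have "\<dots> = (?J ^^ (n - m)) (conv_power (\<lambda>_. 1) m) t"
      using MN that by (rule funpow_conv_cong)
    also have "\<dots> = (?J ^^ (n - m + (m - 1))) (\<lambda>_. 1) t"
      by (simp add: conv_power_def funpow_add)
    also have "n - m + (m - 1) = n - 1"
      using assms(1,2) by simp
    finally show ?thesis
      by (simp add: conv_power_def)
  qed
  ultimately show ?thesis
    using N by (auto simp: luchko_set_def)
qed

end
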